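(* Let $H$ be a complex Hilbert space and let $m\in\mathbb{Z}_{1}$. If $p\in\mathbf{B}(H)_{m-1}[z]$ is a polynomial such that (i) $p(0)=I$, (ii) $p(n)$ is positive and invertible for every $n\in\mathbb{Z}$, (iii) $D(p):=\sup\left\{\dfrac{\langle p(n+1)h,h\rangle}{\langle p(n)h,h\rangle}: n\in\mathbb{Z},\ h\in H,\ h\neq 0\right\}<\infty$, then there exists an $m$-isometric bilateral weighted shift $S\in\mathbf{B}(\ell^{2}(\mathbb{Z},H))$ with positive and invertible weights $(S_{j})_{j\in\mathbb{Z}}\subset\mathbf{B}(H)$ satisfying $$p(n)=\lvert S_{n}\cdots S_{1}\rvert^{2}\quad\text{and}\quad p(-n)=\lvert S_{-n+1}^{*}\cdots S_{0}^{*}\rvert^{-2},\qquad n\in\mathbb{Z}_{1}.$$ Moreover, $\lVert S\rVert=\sqrt{D(p)}$.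
   Context: $\mathbb{Z}_{p}=\{n\in\mathbb{Z}: n\ge p\}$. $\mathbf{B}(H)$ is the algebra of bounded linear operators on a complex Hilbert space $H$; invertible means invertible in $\mathbf{B}(H)$; $\lvert T\rvert=(T^{*}T)^{1/2}$ and, for invertible $T$, $\lvert T\rvert^{-2}=(T^{*}T)^{-1}$. An operator $T\in\mathbf{B}(H)$ is called positive if $\langle Tf,f\rangle>0$ for every $f\in H$, $f\neq 0$. The product $S_{-n+1}^{*}\cdots S_{0}^{*}$ is $S_{-n+1}^{*}S_{-n+2}^{*}\cdots S_{-1}^{*}S_{0}^{*}$ (increasing indices), and $S_{n}\cdots S_{1}$ has decreasing indices. $\ell^{2}(\mathbb{Z},H)$ is the Hilbert space of square-summable two-sided sequences $(h_{i})_{i\in\mathbb{Z}}$ in $H$. For a uniformly bounded sequence $(S_{i})_{i\in\mathbb{Z}}\subset\mathbf{B}(H)$, the bilateral weighted shift $S$ with weights $(S_{i})_{i\in\mathbb{Z}}$ is the bounded operator on $\ell^{2}(\mathbb{Z},H)$ given by $S(h_{i})_{i\in\mathbb{Z}}=(S_{i}h_{i-1})_{i\in\mathbb{Z}}$. A bounded operator $T$ is $m$-isometric ($m\in\mathbb{Z}_{1}$) if $\sum_{k=0}^{m}\binom{m}{k}(-1)^{m-k}T^{*k}T^{k}=0$. $\mathbf{B}(H)_{n}[z]$ denotes the space of polynomials $p(z)=\sum_{j=0}^{n}A_{j}z^{j}$ with coefficients $A_{j}\in\mathbf{B}(H)$ (degree at most $n$), evaluated at scalars $z\in\mathbb{C}$.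 Suprema are taken in $[0,\infty]$. *)

theory Defs
  imports "HOL-Analysis.Analysis"
begin

section \<open>Complex Hilbert spaces\<close>

class complex_vector = real_vector +
  fixes scaleC :: "complex \<Rightarrow> 'a \<Rightarrow> 'a" (infixr "*\<^sub>C" 75)
  assumes scaleC_add_right: "c *\<^sub>C (x + y) = c *\<^sub>C x + c *\<^sub>C y"
    and scaleC_add_left: "(c + d) *\<^sub>C x = c *\<^sub>C x + d *\<^sub>C x"
    and scaleC_scaleC: "c *\<^sub>C (d *\<^sub>C x) = (c * d) *\<^sub>C x"
    and scaleC_of_real: "complex_of_real r *\<^sub>C x = r *\<^sub>R x"

text \<open>
  The inner product is linear in its first argument. Its real part is the inner product of the
  library class \<^class>\<open>real_inner\<close>, so norm, metric and topology, and with them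
  \<^const>\<open>bounded_linear\<close> and \<^const>\<open>onorm\<close>, are those of the library. Positive definiteness
  is inherited from \<^class>\<open>real_inner\<close>, see \<open>cinner_self\<close> below.
\<close>

class complex_inner = complex_vector + real_inner +
  fixes cinner :: "'a \<Rightarrow> 'a \<Rightarrow> complex"
  assumes cinner_commute: "cinner x y = cnj (cinner y x)"
    and cinner_add_left: "cinner (x + y) z = cinner x z + cinner y z"
    and cinner_scaleC_left: "cinner (c *\<^sub>C x) y = c * cinner x y"
    and inner_eq_Re_cinner: "inner x y = Re (cinner x y)"

class complex_hilbert_space = complex_inner + complete_space

lemma cinner_self: "cinner x x = complex_of_real ((norm (x::'a::complex_inner))\<^sup>2)"
proof (rule complex_eqI)
  show "Re (cinner x x) = Re (complex_of_real ((norm x)\<^sup>2))"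
    by (simp add: power2_norm_eq_inner inner_eq_Re_cinner)
  have "Im (cinner x x) = - Im (cinner x x)"
    by (metis cinner_commute cnj.sel(2))
  then show "Im (cinner x x) = Im (complex_of_real ((norm x)\<^sup>2))"
    by simp
qed

lemma norm_scaleC: "norm (c *\<^sub>C x) = cmod c * norm (x::'a::complex_inner)"
proof -
  have "cinner (c *\<^sub>C x) (c *\<^sub>C x) = c * cnj c * cinner x x"
    by (metis cinner_commute cinner_scaleC_left complex_cnj_mult mult.assoc)
  also have "\<dots> = complex_of_real ((cmod c * norm x)\<^sup>2)"
    by (simp add: cinner_self complex_norm_square power_mult_distrib del: of_real_power)
  finally have "(norm (c *\<^sub>C x))\<^sup>2 = (cmod c * norm x)\<^sup>2"
    by (simp only: cinner_self of_real_eq_iff)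
  then show ?thesis
    by (simp add: power2_eq_iff_nonneg)
qed

lemma norm_cinner_le: "cmod (cinner x y) \<le> norm x * norm (y::'a::complex_inner)"
proof (cases "cinner x y = 0")
  case False
  define c where "c = cnj (cinner x y) / cmod (cinner x y)"
  have c: "cmod c = 1"
    using False by (simp add: c_def norm_divide)
  have "c * cinner x y = complex_of_real (cmod (cinner x y))"
    using False complex_norm_square[of "cinner x y"]
    by (simp add: c_def field_simps power2_eq_square)
  then have "cmod (cinner x y) = Re (cinner (c *\<^sub>C x) y)"
    by (simp add: cinner_scaleC_left)
  also have "\<dots> \<le> norm (c *\<^sub>C x) * norm y"
    using norm_cauchy_schwarz[of "c *\<^sub>C x" y] by (simp add: inner_eq_Re_cinner)
  finally show ?thesis
    by (simp add: norm_scaleC c)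
qed simp


section \<open>Square-summable two-sided sequences\<close>

typedef (overloaded) 'a ell2Z =
  "{h :: int \<Rightarrow> 'a::complex_inner. (\<lambda>i. (norm (h i))\<^sup>2) summable_on UNIV}"
  morphisms ell2Z_nth Abs_ell2Z
  by (rule exI[of _ "\<lambda>_. 0"]) simp

setup_lifting type_definition_ell2Z

lemma sq_summable_add:
  fixes h k :: "int \<Rightarrow> 'a::real_normed_vector"
  assumes "(\<lambda>i. (norm (h i))\<^sup>2) summable_on UNIV" "(\<lambda>i. (norm (k i))\<^sup>2) summable_on UNIV"
  shows "(\<lambda>i. (norm (h i + k i))\<^sup>2) summable_on UNIV"
proof (rule summable_on_comparison_test)
  show "(\<lambda>i. 2 * (norm (h i))\<^sup>2 + 2 * (norm (k i))\<^sup>2) summable_on UNIV"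
    by (intro summable_on_add summable_on_cmult_right assms)
  fix i
  have "(norm (h i + k i))\<^sup>2 \<le> (norm (h i) + norm (k i))\<^sup>2"
    by (simp add: norm_triangle_ineq power_mono)
  also have "\<dots> \<le> 2 * (norm (h i))\<^sup>2 + 2 * (norm (k i))\<^sup>2"
    using sum_squares_bound[of "norm (h i)" "norm (k i)"] by (simp add: power2_sum)
  finally show "(norm (h i + k i))\<^sup>2 \<le> 2 * (norm (h i))\<^sup>2 + 2 * (norm (k i))\<^sup>2" .
qed auto

lemma sq_summable_scaleC:
  fixes h :: "int \<Rightarrow> 'a::complex_inner"
  assumes "(\<lambda>i. (norm (h i))\<^sup>2) summable_on UNIV"
  shows "(\<lambda>i. (norm (c *\<^sub>C h i))\<^sup>2) summable_on UNIV"
  by (simp add: norm_scaleC power_mult_distrib summable_on_cmult_right assms)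

lemma cinner_summable:
  fixes h k :: "int \<Rightarrow> 'a::complex_inner"
  assumes "(\<lambda>i. (norm (h i))\<^sup>2) summable_on UNIV" "(\<lambda>i. (norm (k i))\<^sup>2) summable_on UNIV"
  shows "(\<lambda>i. cinner (h i) (k i)) summable_on UNIV"
proof (rule abs_summable_summable, rule summable_on_comparison_test)
  show "(\<lambda>i. (norm (h i))\<^sup>2 + (norm (k i))\<^sup>2) summable_on UNIV"
    by (intro summable_on_add assms)
  fix i
  have "cmod (cinner (h i) (k i)) \<le> norm (h i) * norm (k i)"
    by (rule norm_cinner_le)
  also have "\<dots> \<le> (norm (h i))\<^sup>2 + (norm (k i))\<^sup>2"
    using sum_squares_bound[of "norm (h i)" "norm (k i)"]
      mult_nonneg_nonneg[OF norm_ge_zero norm_ge_zero, of "h i" "k i"] by linarith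
  finally show "cmod (cinner (h i) (k i)) \<le> (norm (h i))\<^sup>2 + (norm (k i))\<^sup>2" .
qed auto

lemma Re_infsum_cinner_self:
  fixes h :: "int \<Rightarrow> 'a::complex_inner"
  assumes "(\<lambda>i. (norm (h i))\<^sup>2) summable_on UNIV"
  shows "Re (\<Sum>\<^sub>\<infinity>i. cinner (h i) (h i)) = (\<Sum>\<^sub>\<infinity>i. (norm (h i))\<^sup>2)"
  using infsum_Re[OF cinner_summable[OF assms assms]]
  by (simp add: cinner_self del: of_real_power)

instantiation ell2Z :: (complex_inner) complex_inner
begin

lift_definition zero_ell2Z :: "'a ell2Z" is "\<lambda>_. 0" by simp

lift_definition plus_ell2Z :: "'a ell2Z \<Rightarrow> 'a ell2Z \<Rightarrow> 'a ell2Z" is "\<lambda>h k i. h i + k i"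
  by (rule sq_summable_add)

lift_definition uminus_ell2Z :: "'a ell2Z \<Rightarrow> 'a ell2Z" is "\<lambda>h i. - h i" by simp

lift_definition minus_ell2Z :: "'a ell2Z \<Rightarrow> 'a ell2Z \<Rightarrow> 'a ell2Z" is "\<lambda>h k i. h i - k i"
  subgoal for h k using sq_summable_add[of h "\<lambda>i. - k i"] by simp
  done

lift_definition scaleC_ell2Z :: "complex \<Rightarrow> 'a ell2Z \<Rightarrow> 'a ell2Z" is "\<lambda>c h i. c *\<^sub>C h i"
  by (rule sq_summable_scaleC)

lift_definition scaleR_ell2Z :: "real \<Rightarrow> 'a ell2Z \<Rightarrow> 'a ell2Z" is "\<lambda>r h i. r *\<^sub>R h i"
  by (simp add: power_mult_distrib summable_on_cmult_right)

lift_definition cinner_ell2Z :: "'a ell2Z \<Rightarrow> 'a ell2Z \<Rightarrow> complex" is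
  "\<lambda>h k. \<Sum>\<^sub>\<infinity>i. cinner (h i) (k i)" .

definition inner_ell2Z :: "'a ell2Z \<Rightarrow> 'a ell2Z \<Rightarrow> real" where
  "inner_ell2Z h k = Re (cinner h k)"

definition norm_ell2Z :: "'a ell2Z \<Rightarrow> real" where
  "norm_ell2Z h = sqrt (inner h h)"

definition dist_ell2Z :: "'a ell2Z \<Rightarrow> 'a ell2Z \<Rightarrow> real" where
  "dist_ell2Z h k = norm (h - k)"

definition sgn_ell2Z :: "'a ell2Z \<Rightarrow> 'a ell2Z" where
  "sgn_ell2Z h = inverse (norm h) *\<^sub>R h"

definition uniformity_ell2Z :: "('a ell2Z \<times> 'a ell2Z) filter" where
  "uniformity_ell2Z = (INF e\<in>{0<..}. principal {(x, y). dist x y < e})"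

definition open_ell2Z :: "'a ell2Z set \<Rightarrow> bool" where
  "open_ell2Z U \<longleftrightarrow> (\<forall>x\<in>U. eventually (\<lambda>(x', y). x' = x \<longrightarrow> y \<in> U) uniformity)"

instance
proof
  fix x y z :: "'a ell2Z" and r s :: real and c d :: complex
  show "x + y + z = x + (y + z)" by transfer (simp add: add.assoc)
  show "x + y = y + x" by transfer (simp add: add.commute)
  show "0 + x = x" by transfer simp
  show "- x + x = 0" by transfer simp
  show "x - y = x + - y" by transfer simp
  show "r *\<^sub>R (x + y) = r *\<^sub>R x + r *\<^sub>R y" by transfer (simp add: scaleR_add_right)
  show "(r + s) *\<^sub>R x = r *\<^sub>R x + s *\<^sub>R x" by transfer (simp add: scaleR_add_left)
  show "r *\<^sub>R s *\<^sub>R x = (r * s) *\<^sub>R x" by transfer simp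
  show "1 *\<^sub>R x = x" by transfer simp
  show "c *\<^sub>C (x + y) = c *\<^sub>C x + c *\<^sub>C y" by transfer (simp add: scaleC_add_right)
  show "(c + d) *\<^sub>C x = c *\<^sub>C x + d *\<^sub>C x" by transfer (simp add: scaleC_add_left)
  show "c *\<^sub>C d *\<^sub>C x = (c * d) *\<^sub>C x" by transfer (simp add: scaleC_scaleC)
  show "complex_of_real r *\<^sub>C x = r *\<^sub>R x" by transfer (simp add: scaleC_of_real)
  show comm: "cinner x y = cnj (cinner y x)" for x y :: "'a ell2Z"
  proof transfer
    fix h k :: "int \<Rightarrow> 'a"
    show "(\<Sum>\<^sub>\<infinity>i. cinner (h i) (k i)) = cnj (\<Sum>\<^sub>\<infinity>i. cinner (k i) (h i))"
      by (simp only: infsum_cnj[symmetric] cinner_commute[symmetric])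
  qed
  show add: "cinner (x + y) z = cinner x z + cinner y z" for x y z :: "'a ell2Z"
    by transfer (simp add: cinner_add_left infsum_add cinner_summable)
  show scale: "cinner (c *\<^sub>C x) y = c * cinner x y" for x :: "'a ell2Z"
    by transfer (simp add: cinner_scaleC_left infsum_cmult_right')
  show "inner x y = Re (cinner x y)" by (rule inner_ell2Z_def)
  show "inner x y = inner y x"
    unfolding inner_ell2Z_def by (subst comm) simp
  show "inner (x + y) z = inner x z + inner y z"
    by (simp add: inner_ell2Z_def add)
  have scaleR: "cinner (r *\<^sub>R x) y = complex_of_real r * cinner x y" for r and x y :: "'a ell2Z"
    by transfer (simp add: scaleC_of_real[symmetric] cinner_scaleC_left infsum_cmult_right')
  show "inner (r *\<^sub>R x) y = r * inner x y"
    by (simp add: inner_ell2Z_def scaleR)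
  have sq: "inner x x = (\<Sum>\<^sub>\<infinity>i. (norm (ell2Z_nth x i))\<^sup>2)"
    unfolding inner_ell2Z_def
    by transfer (rule Re_infsum_cinner_self)
  show "0 \<le> inner x x"
    unfolding sq by (rule infsum_nonneg) simp
  show "inner x x = 0 \<longleftrightarrow> x = 0"
  proof
    assume "inner x x = 0"
    then have "(norm (ell2Z_nth x i))\<^sup>2 = 0" for i
      using ell2Z_nth[of x]
      by (intro nonneg_infsum_le_0D[of "\<lambda>i. (norm (ell2Z_nth x i))\<^sup>2" UNIV]) (auto simp: sq)
    then have "ell2Z_nth x i = 0" for i by simp
    then show "x = 0"
      by (simp add: ell2Z_nth_inject[symmetric] zero_ell2Z.rep_eq fun_eq_iff)
  next
    assume "x = 0"
    then show "inner x x = 0" unfolding sq by (simp add: zero_ell2Z.rep_eq)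
  qed
  show "norm x = sqrt (inner x x)" by (rule norm_ell2Z_def)
  show "dist x y = norm (x - y)" by (rule dist_ell2Z_def)
  show "sgn x = inverse (norm x) *\<^sub>R x" by (rule sgn_ell2Z_def)
  show "uniformity = (INF e\<in>{0<..}. principal {(x, y :: 'a ell2Z). dist x y < e})"
    by (rule uniformity_ell2Z_def)
  show "open U \<longleftrightarrow> (\<forall>x\<in>U. eventually (\<lambda>(x', y). x' = x \<longrightarrow> y \<in> U) uniformity)"
    for U :: "'a ell2Z set"
    by (rule open_ell2Z_def)
qed

end

lemma norm_sq_ell2Z: "(norm x)\<^sup>2 = (\<Sum>\<^sub>\<infinity>i. (norm (ell2Z_nth x i))\<^sup>2)"
  unfolding power2_norm_eq_inner[of x] inner_eq_Re_cinner[of x x]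
  by transfer (rule Re_infsum_cinner_self)

lemma sum_le_norm_sq_ell2Z:
  "finite F \<Longrightarrow> (\<Sum>i\<in>F. (norm (ell2Z_nth x i))\<^sup>2) \<le> (norm x)\<^sup>2"
  unfolding norm_sq_ell2Z using ell2Z_nth[of x] by (intro finite_sum_le_infsum) auto

lemma norm_nth_le_ell2Z: "norm (ell2Z_nth x i) \<le> norm x"
  using sum_le_norm_sq_ell2Z[of "{i}" x] by (simp add: power2_le_iff_abs_le)

instance ell2Z :: (complex_hilbert_space) complex_hilbert_space
proof
  fix X :: "nat \<Rightarrow> 'a ell2Z"
  assume X: "Cauchy X"
  have "Cauchy (\<lambda>n. ell2Z_nth (X n) i)" for i
  proof (rule metric_CauchyI)
    fix e :: real assume "0 < e"
    then obtain M where M: "\<And>m n. m \<ge> M \<Longrightarrow> n \<ge> M \<Longrightarrow> dist (X m) (X n) < e"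
      using metric_CauchyD[OF X] by metis
    have "dist (ell2Z_nth (X m) i) (ell2Z_nth (X n) i) < e" if "m \<ge> M" "n \<ge> M" for m n
      using M[OF that] norm_nth_le_ell2Z[of "X m - X n" i]
      by (simp add: dist_norm minus_ell2Z.rep_eq)
    then show "\<exists>M. \<forall>m\<ge>M. \<forall>n\<ge>M. dist (ell2Z_nth (X m) i) (ell2Z_nth (X n) i) < e"
      by blast
  qed
  then have "\<exists>l. (\<lambda>n. ell2Z_nth (X n) i) \<longlonglongrightarrow> l" for i
    by (simp add: Cauchy_convergent_iff convergent_def)
  then obtain L where L: "\<And>i. (\<lambda>n. ell2Z_nth (X n) i) \<longlonglongrightarrow> L i"
    by metis
  have bound: "\<exists>M. \<forall>n\<ge>M. \<forall>F. finite F \<longrightarrow> (\<Sum>i\<in>F. (norm (ell2Z_nth (X n) i - L i))\<^sup>2) \<le> e\<^sup>2"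
    if "0 < e" for e :: real
  proof -
    obtain M where M: "\<And>m n. m \<ge> M \<Longrightarrow> n \<ge> M \<Longrightarrow> dist (X m) (X n) < e"
      using metric_CauchyD[OF X \<open>0 < e\<close>] by metis
    have "(\<Sum>i\<in>F. (norm (ell2Z_nth (X n) i - L i))\<^sup>2) \<le> e\<^sup>2" if "n \<ge> M" "finite F" for n F
    proof (rule tendsto_upperbound)
      show "(\<lambda>k. \<Sum>i\<in>F. (norm (ell2Z_nth (X n) i - ell2Z_nth (X k) i))\<^sup>2)
          \<longlonglongrightarrow> (\<Sum>i\<in>F. (norm (ell2Z_nth (X n) i - L i))\<^sup>2)"
        by (intro tendsto_intros L)
      have "(\<Sum>i\<in>F. (norm (ell2Z_nth (X n) i - ell2Z_nth (X k) i))\<^sup>2) \<le> e\<^sup>2" if "k \<ge> M" for k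
      proof -
        have "(\<Sum>i\<in>F. (norm (ell2Z_nth (X n) i - ell2Z_nth (X k) i))\<^sup>2) \<le> (norm (X n - X k))\<^sup>2"
          using sum_le_norm_sq_ell2Z[OF \<open>finite F\<close>, of "X n - X k"]
          by (simp add: minus_ell2Z.rep_eq)
        also have "\<dots> \<le> e\<^sup>2"
          using M[OF \<open>n \<ge> M\<close> that] by (intro power_mono) (auto simp: dist_norm)
        finally show ?thesis .
      qed
      then show "\<forall>\<^sub>F k in sequentially.
          (\<Sum>i\<in>F. (norm (ell2Z_nth (X n) i - ell2Z_nth (X k) i))\<^sup>2) \<le> e\<^sup>2"
        using eventually_sequentially by blast
    qed simp
    then show ?thesis by blast
  qed
  have sm: "(\<lambda>i. (norm (f i))\<^sup>2) summable_on UNIV"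
    if "\<And>F. finite F \<Longrightarrow> (\<Sum>i\<in>F. (norm (f i))\<^sup>2) \<le> b" for f :: "int \<Rightarrow> 'a" and b
    by (rule nonneg_bdd_above_summable_on) (auto intro!: bdd_aboveI2 that)
  have sL: "(\<lambda>i. (norm (L i))\<^sup>2) summable_on UNIV"
  proof -
    obtain M where M: "\<And>F. finite F \<Longrightarrow> (\<Sum>i\<in>F. (norm (ell2Z_nth (X M) i - L i))\<^sup>2) \<le> 1\<^sup>2"
      using bound[of 1] by auto
    have "(\<lambda>i. (norm (L i - ell2Z_nth (X M) i))\<^sup>2) summable_on UNIV"
      by (rule sm[of _ "1\<^sup>2"]) (metis (no_types, lifting) M norm_minus_commute sum.cong)
    from sq_summable_add[OF this, of "ell2Z_nth (X M)"] show ?thesis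
      using ell2Z_nth[of "X M"] by simp
  qed
  define x where "x = Abs_ell2Z L"
  have x: "ell2Z_nth x = L"
    using sL by (simp add: x_def Abs_ell2Z_inverse)
  have "X \<longlonglongrightarrow> x"
  proof (rule metric_LIMSEQ_I)
    fix e :: real assume "0 < e"
    then obtain M where M: "\<And>n F. n \<ge> M \<Longrightarrow> finite F \<Longrightarrow>
        (\<Sum>i\<in>F. (norm (ell2Z_nth (X n) i - L i))\<^sup>2) \<le> (e/2)\<^sup>2"
      using bound[of "e/2"] by auto
    have "dist (X n) x < e" if "n \<ge> M" for n
    proof -
      have "(norm (X n - x))\<^sup>2 \<le> (e/2)\<^sup>2"
        unfolding norm_sq_ell2Z
        by (rule infsum_le_finite_sums)
          (use ell2Z_nth[of "X n - x"] M[OF that] in \<open>auto simp: minus_ell2Z.rep_eq x\<close>)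
      then have "norm (X n - x) \<le> e/2"
        by (rule power2_le_imp_le) (use \<open>0 < e\<close> in simp)
      then show ?thesis using \<open>0 < e\<close> by (simp add: dist_norm)
    qed
    then show "\<exists>M. \<forall>n\<ge>M. dist (X n) x < e" by blast
  qed
  then show "convergent X" by (auto simp: convergent_def)
qed


section \<open>Operators\<close>

text \<open>
  An element of the algebra of bounded operators is a function satisfying \<open>bounded_clinear\<close>;
  products and powers are composition and its iterates, and the operator norm is \<^const>\<open>onorm\<close>.
\<close>

definition bounded_clinear :: "('a::complex_inner \<Rightarrow> 'b::complex_inner) \<Rightarrow> bool" where
  "bounded_clinear T \<longleftrightarrow> bounded_linear T \<and> (\<forall>c x. T (c *\<^sub>C x) = c *\<^sub>C T x)"

definition op_invertible :: "('a::complex_inner \<Rightarrow> 'a) \<Rightarrow> bool" where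
  "op_invertible T \<longleftrightarrow> bounded_clinear T \<and> (\<exists>R. bounded_clinear R \<and> T \<circ> R = id \<and> R \<circ> T = id)"

text \<open>The notion of positivity is strict.\<close>

definition op_positive :: "('a::complex_inner \<Rightarrow> 'a) \<Rightarrow> bool" where
  "op_positive T \<longleftrightarrow> bounded_clinear T \<and>
     (\<forall>f. f \<noteq> 0 \<longrightarrow> cinner (T f) f \<in> \<real> \<and> 0 < Re (cinner (T f) f))"

text \<open>
  On a Hilbert space the adjoint of a bounded operator and the positive semidefinite square root
  of a positive semidefinite operator exist and are unique, so the choice in the next two
  definitions is immaterial.
\<close>

definition cadjoint :: "('a::complex_hilbert_space \<Rightarrow> 'a) \<Rightarrow> 'a \<Rightarrow> 'a" where
  "cadjoint T = (SOME R. bounded_clinear R \<and> (\<forall>x y. cinner (T x) y = cinner x (R y)))"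

definition op_sqrt :: "('a::complex_hilbert_space \<Rightarrow> 'a) \<Rightarrow> 'a \<Rightarrow> 'a" where
  "op_sqrt A = (SOME R. bounded_clinear R \<and>
     (\<forall>f. cinner (R f) f \<in> \<real> \<and> 0 \<le> Re (cinner (R f) f)) \<and> R \<circ> R = A)"

definition op_abs :: "('a::complex_hilbert_space \<Rightarrow> 'a) \<Rightarrow> 'a \<Rightarrow> 'a" where
  "op_abs T = op_sqrt (cadjoint T \<circ> T)"

text \<open>The power $|T|^{-2} = (T^* T)^{-1}$, meaningful for invertible $T$ only.\<close>

definition op_abs_inv_sq :: "('a::complex_hilbert_space \<Rightarrow> 'a) \<Rightarrow> 'a \<Rightarrow> 'a" where
  "op_abs_inv_sq T = inv (cadjoint T \<circ> T)"

definition op_prod :: "('a \<Rightarrow> 'a) list \<Rightarrow> 'a \<Rightarrow> 'a" where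
  "op_prod Ts = foldr (\<circ>) Ts id"

definition m_isometric :: "nat \<Rightarrow> ('a::complex_hilbert_space \<Rightarrow> 'a) \<Rightarrow> bool" where
  "m_isometric m T \<longleftrightarrow> bounded_clinear T \<and>
     (\<forall>f. (\<Sum>k=0..m. (of_nat (m choose k) * (-1) ^ (m - k)) *\<^sub>C
        ((cadjoint T ^^ k) ((T ^^ k) f))) = 0)"

definition bilateral_weighted_shift ::
    "(int \<Rightarrow> 'a::complex_hilbert_space \<Rightarrow> 'a) \<Rightarrow> ('a ell2Z \<Rightarrow> 'a ell2Z) \<Rightarrow> bool" where
  "bilateral_weighted_shift W S \<longleftrightarrow>
     (\<forall>i. bounded_clinear (W i)) \<and> (\<exists>K. \<forall>i. onorm (W i) \<le> K) \<and>
     bounded_clinear S \<and> (\<forall>h i. ell2Z_nth (S h) i = W i (ell2Z_nth h (i - 1)))"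

text \<open>Polynomials of degree at most \<open>n\<close> with operator coefficients, as functions of a scalar.\<close>

definition op_polys :: "nat \<Rightarrow> (complex \<Rightarrow> 'a::complex_inner \<Rightarrow> 'a) set" where
  "op_polys n = {p. \<exists>A. (\<forall>j\<le>n. bounded_clinear (A j)) \<and>
     p = (\<lambda>z h. \<Sum>j=0..n. z ^ j *\<^sub>C A j h)}"

text \<open>
  The supremum $D(p)$ in $[0,\infty]$. When all \<open>p (of_int n)\<close> are positive the quotients are
  positive reals, and \<^const>\<open>Re\<close> is only a coercion. Over the zero space the supremum of the
  empty set is \<open>0\<close>.
\<close>

definition growth_sup :: "(complex \<Rightarrow> 'a::complex_inner \<Rightarrow> 'a) \<Rightarrow> ennreal" where
  "growth_sup p = (SUP (n, h) \<in> (UNIV :: int set) \<times> {h. h \<noteq> 0}.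
     ennreal (Re (cinner (p (of_int (n + 1)) h) h / cinner (p (of_int n) h) h)))"

end

theory Submission
  imports Defs
begin

text \<open>
  Invertible operators \<open>X\<^sub>j\<close> with \<open>X\<^sub>j\<^sup>* X\<^sub>j = p(j)\<close>, \<open>X\<^sub>0 = I\<close> and \<open>X\<^sub>j = W\<^sub>j X\<^sub>j\<^sub>-\<^sub>1\<close> for positive
  invertible \<open>W\<^sub>j\<close> are built outwards from \<open>0\<close>: given \<open>X\<close> with \<open>X\<^sup>* X = q\<close>, the operator
  \<open>X q\<^sup>-\<^sup>1 q' X\<^sup>-\<^sup>1 = (X\<^sup>*)\<^sup>-\<^sup>1 q' X\<^sup>-\<^sup>1\<close> is positive and invertible, and its positive square root \<open>V\<close>
  satisfies \<open>(V X)\<^sup>* (V X) = q'\<close>. The shift \<open>S\<close> with weights \<open>W\<^sub>j\<close> has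
  \<open>\<parallel>S\<^sup>k f\<parallel>\<^sup>2 = \<Sum>\<^sub>j \<langle>p(j + k) u\<^sub>j, u\<^sub>j\<rangle>\<close> with \<open>u\<^sub>j = X\<^sub>j\<^sup>-\<^sup>1 f\<^sub>j\<close>, so the \<open>m\<close>-isometry identity is
  the vanishing of the \<open>m\<close>-th difference of a polynomial of degree less than \<open>m\<close>. Substituting
  \<open>x = X\<^sub>j h\<close> in \<open>\<parallel>W\<^sub>j\<^sub>+\<^sub>1 x\<parallel>\<^sup>2 / \<parallel>x\<parallel>\<^sup>2\<close> gives the quotients defining \<open>D(p)\<close>.
\<close>

section \<open>Complex inner products\<close>

text \<open>Square roots will be found as fixed points in the space of bounded operators, whose
  completeness rests on this instance.\<close>

instance complex_hilbert_space \<subseteq> banach ..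

lemma cinner_add_right: "cinner x (y + z) = cinner x y + cinner x (z::'a::complex_inner)"
  by (metis cinner_add_left cinner_commute complex_cnj_add)

lemma cinner_scaleC_right: "cinner x (c *\<^sub>C y) = cnj c * cinner x (y::'a::complex_inner)"
  by (metis cinner_commute cinner_scaleC_left complex_cnj_mult)

lemma bounded_linear_cinner_left: "bounded_linear (\<lambda>x::'a::complex_inner. cinner x y)"
proof (rule bounded_linear_intro)
  fix x z :: 'a and r
  show "cinner (x + z) y = cinner x y + cinner z y" by (rule cinner_add_left)
  show "cinner (r *\<^sub>R x) y = r *\<^sub>R cinner x y"
    by (simp add: cinner_scaleC_left scaleC_of_real[symmetric] scaleR_conv_of_real)
  show "cmod (cinner x y) \<le> norm x * norm y" by (rule norm_cinner_le)
qed

lemma bounded_linear_cinner_right: "bounded_linear (\<lambda>y::'a::complex_inner. cinner x y)"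
proof (rule bounded_linear_intro)
  fix y z :: 'a and r
  show "cinner x (y + z) = cinner x y + cinner x z" by (rule cinner_add_right)
  show "cinner x (r *\<^sub>R y) = r *\<^sub>R cinner x y"
    by (simp add: cinner_scaleC_right scaleC_of_real[symmetric] scaleR_conv_of_real)
  show "cmod (cinner x y) \<le> norm y * norm x"
    using norm_cinner_le[of x y] by (simp add: mult.commute)
qed

lemmas cinner_diff_left = linear_diff[OF bounded_linear.linear[OF bounded_linear_cinner_left]]
lemmas cinner_scaleR_left = linear_scale[OF bounded_linear.linear[OF bounded_linear_cinner_left]]
lemmas cinner_sum_left = linear_sum[OF bounded_linear.linear[OF bounded_linear_cinner_left]]
lemmas cinner_zero_left = linear_0[OF bounded_linear.linear[OF bounded_linear_cinner_left]]
lemmas cinner_zero_right = linear_0[OF bounded_linear.linear[OF bounded_linear_cinner_right]]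
lemmas cinner_diff_right = linear_diff[OF bounded_linear.linear[OF bounded_linear_cinner_right]]
lemmas cinner_scaleR_right = linear_scale[OF bounded_linear.linear[OF bounded_linear_cinner_right]]

lemma cinner_ext:
  fixes x z :: "'a::complex_inner"
  assumes "\<And>y. cinner x y = cinner z y"
  shows "x = z"
proof -
  have "inner (x - z) (x - z) = 0"
    using assms[of "x - z"] by (simp add: inner_eq_Re_cinner cinner_diff_left)
  then show ?thesis by simp
qed

section \<open>Bounded operators\<close>

lemma bounded_clinear_id [intro]: "bounded_clinear id"
  by (simp add: bounded_clinear_def id_def)

lemma bounded_clinear_compose [intro]:
  "bounded_clinear S \<Longrightarrow> bounded_clinear T \<Longrightarrow> bounded_clinear (S \<circ> T)"
  unfolding bounded_clinear_def comp_def by (auto intro: bounded_linear_compose)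

lemma op_invertible_bounded: "op_invertible T \<Longrightarrow> bounded_clinear T"
  by (simp add: op_invertible_def)

lemma op_invertible_bij: "op_invertible T \<Longrightarrow> bij T"
  unfolding op_invertible_def using o_bij by metis

lemma op_invertible_inv:
  assumes "op_invertible T"
  shows "op_invertible (inv T)"
proof -
  obtain R where R: "bounded_clinear T" "bounded_clinear R" "T \<circ> R = id" "R \<circ> T = id"
    using assms by (auto simp: op_invertible_def)
  have "inv T = R" using R(3,4) by (metis inv_unique_comp)
  then show ?thesis using R by (auto simp: op_invertible_def)
qed

lemma op_invertible_id [intro]: "op_invertible id"
  unfolding op_invertible_def by (auto intro!: exI[of _ id])

lemma op_invertible_compose [intro]:
  assumes "op_invertible S" "op_invertible T"
  shows "op_invertible (S \<circ> T)"
proof -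
  obtain R Q where "bounded_clinear S" "bounded_clinear R" "S \<circ> R = id" "R \<circ> S = id"
    and "bounded_clinear T" "bounded_clinear Q" "T \<circ> Q = id" "Q \<circ> T = id"
    using assms by (auto simp: op_invertible_def)
  then show ?thesis
    unfolding op_invertible_def
    by (intro conjI exI[of _ "Q \<circ> R"]) (auto simp: fun_eq_iff)
qed

lemma op_invertible_apply_inv:
  "op_invertible T \<Longrightarrow> T (inv T x) = x" "op_invertible T \<Longrightarrow> inv T (T x) = x"
  using op_invertible_bij[of T] by (simp_all add: bij_is_surj surj_f_inv_f bij_is_inj)

text \<open>Over the complex numbers, real-valuedness of the quadratic form already gives symmetry.\<close>

lemma op_positive_symmetric:
  fixes T :: "'a::complex_inner \<Rightarrow> 'a"
  assumes "op_positive T"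
  shows "cinner (T x) y = cinner x (T y)"
proof -
  have lin: "T (u + v) = T u + T v" "T (c *\<^sub>C u) = c *\<^sub>C T u" for u v c
    using assms by (auto simp: op_positive_def bounded_clinear_def linear_add bounded_linear.linear)
  have real: "Im (cinner (T u) u) = 0" for u
    using assms by (cases "u = 0") (auto simp: op_positive_def complex_is_Real_iff
      linear_0 bounded_linear.linear bounded_clinear_def cinner_zero_left)
  have a: "Im (cinner (T u) v) + Im (cinner (T v) u) = 0" for u v
    using real[of "u + v"] real[of u] real[of v]
    by (simp add: lin cinner_add_left cinner_add_right)
  have "Re (cinner (T x) y) = Re (cinner (T y) x)"
    using a[of x "\<i> *\<^sub>C y"] by (simp add: lin cinner_scaleC_left cinner_scaleC_right)
  moreover have "Im (cinner (T x) y) = - Im (cinner (T y) x)"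
    using a[of x y] by simp
  ultimately show ?thesis
    by (subst cinner_commute[of x]) (simp add: complex_eq_iff)
qed

lemma op_positive_inv:
  assumes "op_positive T" "op_invertible T"
  shows "op_positive (inv T)"
  unfolding op_positive_def
proof (intro conjI allI impI)
  show "bounded_clinear (inv T)"
    using assms(2) by (intro op_invertible_bounded op_invertible_inv)
  fix f :: 'a assume "f \<noteq> 0"
  have T0: "T 0 = 0"
    using assms by (auto simp: op_positive_def bounded_clinear_def linear_0 bounded_linear.linear)
  then have "inv T f \<noteq> 0"
    using \<open>f \<noteq> 0\<close> op_invertible_apply_inv(1)[OF assms(2), of f] by auto
  then have "cinner (T (inv T f)) (inv T f) \<in> \<real>" "0 < Re (cinner (T (inv T f)) (inv T f))"
    using assms(1) by (auto simp: op_positive_def)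
  then have *: "cinner f (inv T f) \<in> \<real>" "0 < Re (cinner f (inv T f))"
    by (simp_all add: op_invertible_apply_inv[OF assms(2)])
  then show "0 < Re (cinner (inv T f) f)" "cinner (inv T f) f \<in> \<real>"
    using cinner_commute[of "inv T f" f] by (simp_all add: complex_is_Real_iff)
qed

text \<open>
  Adjoints are only needed for operators whose adjoint is explicitly known, so the Riesz
  representation theorem is not used.
\<close>

lemma cadjoint_eqI:
  assumes "bounded_clinear R" "\<And>x y. cinner (T x) y = cinner x (R y)"
  shows "cadjoint T = R"
proof -
  have "bounded_clinear (cadjoint T) \<and> (\<forall>x y. cinner (T x) y = cinner x (cadjoint T y))"
    unfolding cadjoint_def by (rule someI[of _ R]) (use assms in auto)
  then have eq: "cinner x (cadjoint T y) = cinner x (R y)" for x y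
    using assms(2)[of x y] by simp
  show ?thesis
  proof (intro ext cinner_ext)
    show "cinner (cadjoint T y) x = cinner (R y) x" for x y
      using eq[of x y] cinner_commute[of "cadjoint T y" x] cinner_commute[of "R y" x] by simp
  qed
qed

lemma cadjoint_op_positive: "op_positive T \<Longrightarrow> cadjoint T = T"
  by (rule cadjoint_eqI[OF _ op_positive_symmetric]) (auto simp: op_positive_def)

section \<open>Square roots of positive invertible operators\<close>

text \<open>Strict positivity is pointwise; invertibility makes it uniform. The inverse bounds
  \<open>norm x\<close> by a multiple of \<open>norm (A x)\<close>, and the form of \<open>A\<close>
  controls \<open>norm (A x)\<close>. The constant \<open>e\<close> drives the contraction behind
  the square root.\<close>

lemma op_positive_bounded_below:
  fixes A :: "'a::complex_inner \<Rightarrow> 'a"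
  assumes pos: "op_positive A" and inv: "op_invertible A"
  obtains e where "0 < e" "\<And>x. e * (norm x)\<^sup>2 \<le> inner (A x) x"
proof -
  have A: "bounded_linear A" using pos by (auto simp: op_positive_def bounded_clinear_def)
  note lin = linear_diff[OF bounded_linear.linear[OF A]] linear_scale[OF bounded_linear.linear[OF A]]
  obtain c where c: "0 < c" "\<And>x. norm (A x) \<le> norm x * c"
    using bounded_linear.pos_bounded[OF A] by blast
  have "bounded_linear (inv A)"
    using op_invertible_bounded[OF op_invertible_inv[OF inv]] by (simp add: bounded_clinear_def)
  then obtain d where d: "0 < d" "\<And>x. norm (inv A x) \<le> norm x * d"
    using bounded_linear.pos_bounded by blast
  have nonneg: "0 \<le> inner (A x) x" for x
    using pos by (cases "x = 0") (auto simp: op_positive_def inner_eq_Re_cinner cinner_zero_right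
      intro: less_imp_le)
  have sym: "inner (A x) y = inner x (A y)" for x y
    by (simp add: inner_eq_Re_cinner op_positive_symmetric[OF pos])
  have "1 / (c * d\<^sup>2) * (norm x)\<^sup>2 \<le> inner (A x) x" for x
  proof -
    have "inner (A (A x)) (A x) \<le> norm (A (A x)) * norm (A x)" by (rule norm_cauchy_schwarz)
    also have "\<dots> \<le> c * (norm (A x))\<^sup>2"
      using mult_right_mono[OF c(2)[of "A x"], of "norm (A x)"] by (simp add: power2_eq_square mult_ac)
    finally have 1: "inner (A (A x)) (A x) \<le> c * (norm (A x))\<^sup>2" .
    \<comment> \<open>Completing the square: the form at \<open>x - (1/c) *\<^sub>R A x\<close>,
      together with estimate \<open>1\<close>, gives \<open>norm (A x)\<close> squared at most
      \<open>c * inner (A x) x\<close>.\<close>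
    have "0 \<le> inner (A (x - (1/c) *\<^sub>R A x)) (x - (1/c) *\<^sub>R A x)" by (rule nonneg)
    also have "\<dots> = inner (A x) x - 2 / c * (norm (A x))\<^sup>2 + 1 / c\<^sup>2 * inner (A (A x)) (A x)"
      by (simp add: lin inner_diff_left inner_diff_right sym[of "A x" x] dot_square_norm
          power2_eq_square diff_divide_distrib)
    also have "\<dots> \<le> inner (A x) x - 2 / c * (norm (A x))\<^sup>2 + 1 / c\<^sup>2 * (c * (norm (A x))\<^sup>2)"
      using 1 by (intro add_mono mult_left_mono) auto
    also have "\<dots> = inner (A x) x - (norm (A x))\<^sup>2 / c"
      using c(1) by (simp add: field_simps power2_eq_square)
    finally have 2: "(norm (A x))\<^sup>2 / c \<le> inner (A x) x" by simp
    have "(norm x)\<^sup>2 \<le> (norm (A x) * d)\<^sup>2"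
      using d(2)[of "A x"] by (simp add: op_invertible_apply_inv[OF inv] power_mono)
    then have "(norm x)\<^sup>2 / (c * d\<^sup>2) \<le> (norm (A x))\<^sup>2 / c"
      using c(1) d(1) by (simp add: field_simps power_mult_distrib)
    with 2 show ?thesis by simp
  qed
  then show ?thesis using that[of "1 / (c * d\<^sup>2)"] c(1) d(1) by simp
qed

text \<open>Bounded operators of type \<open>blinfun\<close> are only real-linear. Symmetry for the
  complex inner product restores complex homogeneity, because a scalar can be moved through the
  first argument.\<close>

lemma bounded_clinear_symmetricI:
  fixes T :: "'a::complex_inner \<Rightarrow> 'a"
  assumes "bounded_linear T" "\<And>x y. cinner (T x) y = cinner x (T y)"
  shows "bounded_clinear T"
  unfolding bounded_clinear_def
proof (intro conjI allI assms(1))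
  show "T (c *\<^sub>C x) = c *\<^sub>C T x" for c x
    by (rule cinner_ext) (simp add: assms(2) cinner_scaleC_left)
qed

text \<open>
  The substitution \<open>R = I - Y\<close>, \<open>A = I - B\<close> turns \<open>R\<^sup>2 = A\<close> into \<open>Y = (B + Y\<^sup>2) / 2\<close>. When
  \<open>\<parallel>B\<parallel> \<le> b < 1\<close>, the right-hand side is a contraction of the ball of radius \<open>b\<close>, and it
  preserves symmetric operators.
\<close>

lemma symmetric_sqrt_near_id:
  fixes B :: "'a::complex_hilbert_space \<Rightarrow>\<^sub>L 'a"
  assumes B: "norm B \<le> b" "b < 1" and symB: "\<And>x y. cinner (B x) y = cinner x (B y)"
  obtains Y :: "'a \<Rightarrow>\<^sub>L 'a" where "norm Y \<le> b"
    "\<And>x y. cinner (blinfun_apply Y x) y = cinner x (blinfun_apply Y y)"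
    "\<And>x. 2 *\<^sub>R blinfun_apply Y x = B x + blinfun_apply Y (blinfun_apply Y x)"
proof -
  have b: "0 \<le> b" using B(1) norm_ge_zero order_trans by blast
  define s where
    "s = {Y :: 'a \<Rightarrow>\<^sub>L 'a. norm Y \<le> b \<and> (\<forall>x y. cinner (blinfun_apply Y x) y = cinner x (blinfun_apply Y y))}"
  define F where "F Y = (1/2) *\<^sub>R (B + (Y o\<^sub>L Y))" for Y :: "'a \<Rightarrow>\<^sub>L 'a"
  have F_apply: "blinfun_apply (F Y) x = (1/2) *\<^sub>R (B x + blinfun_apply Y (blinfun_apply Y x))" for Y x
    by (simp add: F_def blinfun.add_left blinfun.scaleR_left)
  have "closed {Y :: 'a \<Rightarrow>\<^sub>L 'a. cinner (blinfun_apply Y x) y = cinner x (blinfun_apply Y y)}" for x y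
    by (intro closed_Collect_eq bounded_linear.continuous_on[OF bounded_linear_cinner_left]
        bounded_linear.continuous_on[OF bounded_linear_cinner_right] continuous_intros)
  moreover have "closed {Y :: 'a \<Rightarrow>\<^sub>L 'a. norm Y \<le> b}"
    by (intro closed_Collect_le continuous_intros)
  ultimately have "closed s"
    unfolding s_def by (intro closed_Collect_conj closed_Collect_all) auto
  moreover have "0 \<in> s" using b by (simp add: s_def cinner_zero_left cinner_zero_right)
  moreover have "F Y \<in> s" if "Y \<in> s" for Y
  proof -
    have Y: "norm Y \<le> b" "\<And>x y. cinner (blinfun_apply Y x) y = cinner x (blinfun_apply Y y)" using that by (auto simp: s_def)
    have "norm (F Y) \<le> (norm B + norm Y * norm Y) / 2"
      using norm_triangle_ineq[of B "Y o\<^sub>L Y"] norm_blinfun_compose[of Y Y] by (simp add: F_def)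
    also have "\<dots> \<le> (b + b * 1) / 2"
      using B Y(1) b by (intro divide_right_mono add_mono mult_mono) auto
    finally have "norm (F Y) \<le> b" by simp
    then show ?thesis
      by (simp add: s_def F_apply cinner_add_left cinner_add_right cinner_scaleR_left
          cinner_scaleR_right symB Y(2))
  qed
  moreover have "dist (F Y) (F Z) \<le> b * dist Y Z" if "Y \<in> s" "Z \<in> s" for Y Z
  proof -
    \<comment> \<open>The difference of squares for noncommuting factors. Both norms are at most
      \<open>b\<close>, so the factor 1/2 leaves the Lipschitz constant \<open>b\<close>.\<close>
    have "F Y - F Z = (1/2) *\<^sub>R ((Y o\<^sub>L (Y - Z)) + ((Y - Z) o\<^sub>L Z))"
      by (rule blinfun_eqI) (simp add: F_def blinfun.bilinear_simps algebra_simps)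
    then have "norm (F Y - F Z) \<le> (norm Y * norm (Y - Z) + norm (Y - Z) * norm Z) / 2"
      using norm_triangle_ineq[of "Y o\<^sub>L (Y - Z)" "(Y - Z) o\<^sub>L Z"]
        norm_blinfun_compose[of Y "Y - Z"] norm_blinfun_compose[of "Y - Z" Z] by simp
    also have "\<dots> \<le> (b * norm (Y - Z) + norm (Y - Z) * b) / 2"
      using that by (intro divide_right_mono add_mono mult_mono) (auto simp: s_def b)
    finally show ?thesis by (simp add: dist_norm)
  qed
  ultimately have "\<exists>!Y\<in>s. F Y = Y"
    using b B(2) by (intro Banach_fix[of s b F]) (auto simp: complete_eq_closed)
  then obtain Y where Y: "Y \<in> s" "F Y = Y" by blast
  have "2 *\<^sub>R blinfun_apply Y x = B x + blinfun_apply Y (blinfun_apply Y x)" for x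
    using arg_cong[OF F_apply[of Y x], of "scaleR 2"] by (simp add: Y(2))
  with Y that show ?thesis by (auto simp: s_def)
qed

text \<open>Rescaling by a suitable \<open>t\<close> brings \<open>t A\<close> close enough to the
  identity for the fixed-point construction; dividing \<open>I - Y\<close> by \<open>sqrt t\<close>
  undoes the scaling.\<close>

lemma op_positive_sqrt:
  fixes A :: "'a::complex_hilbert_space \<Rightarrow> 'a"
  assumes pos: "op_positive A" and inv: "op_invertible A"
  obtains R where "op_positive R" "op_invertible R" "R \<circ> R = A"
proof -
  have A: "bounded_linear A" using pos by (auto simp: op_positive_def bounded_clinear_def)
  obtain c where c: "0 < c" "\<And>x. norm (A x) \<le> norm x * c"
    using bounded_linear.pos_bounded[OF A] by blast
  obtain e where e: "0 < e" "\<And>x. e * (norm x)\<^sup>2 \<le> inner (A x) x"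
    using op_positive_bounded_below[OF pos inv] by metis
  \<comment> \<open>This value minimizes \<open>1 - 2 * t * e + t\<^sup>2 * c\<^sup>2\<close>, the
    bound for the squared norm of \<open>I - t A\<close>; the minimum is
    \<open>1 - e\<^sup>2 / c\<^sup>2\<close>.\<close>
  define t where "t = e / c\<^sup>2"
  have t: "0 < t" using c(1) e(1) by (simp add: t_def)
  \<comment> \<open>On a nonzero space \<open>e \<le> c\<close> holds automatically; on the zero
    space \<open>e\<close> may exceed \<open>c\<close>, hence the maximum with 0.\<close>
  define b where "b = sqrt (max 0 (1 - e\<^sup>2 / c\<^sup>2))"
  have b: "0 \<le> b" "b < 1"
    using c(1) e(1) by (auto simp: b_def max_def)
  have bl: "bounded_linear (\<lambda>x. x - t *\<^sub>R A x)"
    by (intro bounded_linear_sub bounded_linear_const_scaleR A) auto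
  define B where "B = Blinfun (\<lambda>x. x - t *\<^sub>R A x)"
  have B: "blinfun_apply B x = x - t *\<^sub>R A x" for x
    by (simp add: B_def bounded_linear_Blinfun_apply[OF bl])
  have "norm (B x) \<le> b * norm x" for x
  proof -
    have "(norm (B x))\<^sup>2 = (norm x)\<^sup>2 - 2 * t * inner (A x) x + t\<^sup>2 * (norm (A x))\<^sup>2"
      unfolding power2_norm_eq_inner
      by (simp add: B inner_diff_left inner_diff_right inner_commute power2_eq_square algebra_simps)
    also have "\<dots> \<le> (norm x)\<^sup>2 - 2 * t * (e * (norm x)\<^sup>2) + t\<^sup>2 * (norm x * c)\<^sup>2"
      using e(2) c(2) t by (intro add_mono diff_mono mult_left_mono power_mono) auto
    also have "\<dots> = (1 - e\<^sup>2 / c\<^sup>2) * (norm x)\<^sup>2"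
      using c(1) by (simp add: t_def field_simps power2_eq_square)
    also have "\<dots> \<le> b\<^sup>2 * (norm x)\<^sup>2"
      by (intro mult_right_mono) (auto simp: b_def)
    finally have "(norm (B x))\<^sup>2 \<le> (b * norm x)\<^sup>2" by (simp add: power_mult_distrib)
    then show ?thesis by (rule power2_le_imp_le) (simp add: b(1))
  qed
  then have "norm B \<le> b" by (intro norm_blinfun_bound b)
  moreover have "cinner (B x) y = cinner x (B y)" for x y
    by (simp add: B cinner_diff_left cinner_diff_right cinner_scaleR_left cinner_scaleR_right
        op_positive_symmetric[OF pos])
  ultimately obtain Y :: "'a \<Rightarrow>\<^sub>L 'a" where Y: "norm Y \<le> b"
      "\<And>x y. cinner (blinfun_apply Y x) y = cinner x (blinfun_apply Y y)"
      "\<And>x. 2 *\<^sub>R blinfun_apply Y x = B x + blinfun_apply Y (blinfun_apply Y x)"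
    using symmetric_sqrt_near_id[OF _ b(2)] by blast
  define R where "R x = (1 / sqrt t) *\<^sub>R (x - Y x)" for x
  have R_lin: "bounded_linear R"
    unfolding R_def[abs_def]
    by (intro bounded_linear_const_scaleR bounded_linear_sub blinfun.bounded_linear_right) auto
  have R_sym: "cinner (R x) y = cinner x (R y)" for x y
    by (simp add: R_def cinner_diff_left cinner_diff_right cinner_scaleR_left cinner_scaleR_right
        Y(2))
  have R: "bounded_clinear R" by (rule bounded_clinear_symmetricI[OF R_lin R_sym])
  have "0 < Re (cinner (R x) x)" if "x \<noteq> 0" for x
  proof -
    have "inner (Y x) x \<le> norm (Y x) * norm x" by (rule norm_cauchy_schwarz)
    also have "\<dots> \<le> b * norm x * norm x"
      using norm_blinfun[of Y x] mult_right_mono[OF Y(1), of "norm x"]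
      by (intro mult_right_mono) auto
    also have "\<dots> < inner x x"
      using b(2) that by (simp add: power2_norm_eq_inner[symmetric] power2_eq_square)
    finally have "0 < 1 / sqrt t * (inner x x - inner (Y x) x)" using t by simp
    also have "\<dots> = inner (R x) x" by (simp add: R_def inner_diff_left)
    finally show ?thesis by (simp add: inner_eq_Re_cinner)
  qed
  moreover have "cinner (R x) x \<in> \<real>" for x
    using R_sym[of x x] cinner_commute[of "R x" x] by (simp add: Reals_cnj_iff)
  ultimately have R_pos: "op_positive R" using R by (simp add: op_positive_def)
  \<comment> \<open>The square of \<open>I - Y\<close> is \<open>I - 2 Y + Y\<^sup>2\<close>, which
    the fixed-point equation turns into \<open>I - B = t A\<close>.\<close>
  have RR: "R (R x) = A x" for x
  proof -
    have "R (R x) = (1 / sqrt t * (1 / sqrt t)) *\<^sub>R (x - Y x - (Y x - Y (Y x)))"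
      by (simp only: R_def blinfun.scaleR_right blinfun.diff_right
          scaleR_diff_right[symmetric] scaleR_scaleR)
    also have "\<dots> = (1 / t) *\<^sub>R (x - 2 *\<^sub>R Y x + Y (Y x))"
      using t by (simp add: scaleR_2 algebra_simps)
    also have "\<dots> = A x" using t by (simp add: Y(3) B)
    finally show ?thesis .
  qed
  \<comment> \<open>Composing with \<open>inv A\<close> on either side gives a right and a left
    inverse of \<open>R\<close>, which therefore coincide.\<close>
  have "bounded_clinear (R \<circ> inv A)" "bounded_clinear (inv A \<circ> R)"
    using R op_invertible_bounded[OF op_invertible_inv[OF inv]] by auto
  moreover have right: "R \<circ> (R \<circ> inv A) = id" and left: "(inv A \<circ> R) \<circ> R = id"
    using op_invertible_apply_inv[OF inv] by (auto simp: RR)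
  moreover have "R \<circ> inv A = inv A \<circ> R"
    by (metis (no_types) right left comp_assoc comp_id id_comp)
  ultimately have "op_invertible R" using R by (auto simp: op_invertible_def)
  with R_pos RR that show ?thesis by (auto simp: fun_eq_iff)
qed

text \<open>\<open>op_sqrt\<close> is a choice; the existence of one square root guarantees that the
  chosen operator squares to \<open>A\<close>.\<close>

lemma op_abs_squared:
  assumes "cadjoint X \<circ> X = A" "op_positive A" "op_invertible A"
  shows "op_abs X ^^ 2 = A"
proof -
  obtain R where R: "op_positive R" "R \<circ> R = A" using op_positive_sqrt[OF assms(2,3)] by blast
  have "cinner (R f) f \<in> \<real> \<and> 0 \<le> Re (cinner (R f) f)" for f
    using R(1) by (cases "f = 0") (auto simp: op_positive_def bounded_clinear_def
      cinner_zero_left linear_0 bounded_linear.linear less_imp_le)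
  then have "op_sqrt A \<circ> op_sqrt A = A"
    unfolding op_sqrt_def
    using someI[of "\<lambda>R. bounded_clinear R \<and>
      (\<forall>f. cinner (R f) f \<in> \<real> \<and> 0 \<le> Re (cinner (R f) f)) \<and> R \<circ> R = A" R] R
    by (auto simp: op_positive_def)
  then show ?thesis by (simp add: op_abs_def assms(1) numeral_2_eq_2)
qed

section \<open>Factorization of a sequence of positive operators\<close>

text \<open>The Gram identity says that the adjoint of \<open>X\<close> must be
  \<open>q \<circ> inv X\<close>, which serves as the explicit witness.\<close>

lemma cadjoint_compose_self:
  assumes X: "op_invertible X" and q: "op_positive q"
    and gram: "\<And>x y. cinner (X x) (X y) = cinner (q x) y"
  shows "cadjoint X \<circ> X = q"
proof -
  have "cadjoint X = q \<circ> inv X"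
  proof (rule cadjoint_eqI)
    show "bounded_clinear (q \<circ> inv X)"
      using q op_invertible_bounded[OF op_invertible_inv[OF X]] by (auto simp: op_positive_def)
    show "cinner (X x) y = cinner x ((q \<circ> inv X) y)" for x y
      using gram[of x "inv X y"] op_positive_symmetric[OF q, of x "inv X y"]
      by (simp add: op_invertible_apply_inv[OF X])
  qed
  then show ?thesis by (auto simp: fun_eq_iff op_invertible_apply_inv[OF X])
qed

text \<open>Here \<open>T\<close> is the adjoint of the inverse of \<open>X\<close>, so
  \<open>T* T\<close> is the inverse of \<open>X* X = q\<close>. This handles the negative
  indices.\<close>

lemma op_abs_inv_sq_eq:
  assumes X: "op_invertible X" and q: "op_invertible q"
    and gram: "\<And>x y. cinner (X x) (X y) = cinner (q x) y"
    and T: "\<And>x y. cinner (T x) y = cinner x (inv X y)"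
  shows "op_abs_inv_sq T = q"
proof -
  have T': "cadjoint T = inv X"
    using X T by (intro cadjoint_eqI op_invertible_bounded op_invertible_inv)
  have "q (inv X (T x)) = x" for x
  proof (rule cinner_ext)
    fix y
    have "cinner (q (inv X (T x))) y = cinner (T x) (X y)"
      using gram[of "inv X (T x)" y] by (simp add: op_invertible_apply_inv[OF X])
    then show "cinner (q (inv X (T x))) y = cinner x y"
      by (simp add: T op_invertible_apply_inv[OF X])
  qed
  then have "(inv X \<circ> T) x = inv q x" for x
    by (metis comp_apply op_invertible_apply_inv(2)[OF q])
  then have "inv X \<circ> T = inv q" ..
  then show ?thesis
    by (simp add: op_abs_inv_sq_def T' inv_inv_eq op_invertible_bij[OF q])
qed

lemma op_factor_step:
  fixes X q q' :: "'a::complex_hilbert_space \<Rightarrow> 'a"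
  assumes X: "op_invertible X" and q: "op_invertible q" and q': "op_positive q'" "op_invertible q'"
    and gram: "\<And>x y. cinner (X x) (X y) = cinner (q x) y"
  obtains V where "op_positive V" "op_invertible V"
    "\<And>x y. cinner (V (X x)) (V (X y)) = cinner (q' x) y"
proof -
  define A where "A = X \<circ> inv q \<circ> q' \<circ> inv X"
  have A_X: "cinner (A (X x)) (X y) = cinner (q' x) y" for x y
    by (simp add: A_def gram op_invertible_apply_inv[OF X] op_invertible_apply_inv[OF q])
  have inv: "op_invertible A"
    unfolding A_def by (intro op_invertible_compose op_invertible_inv X q q')
  have "op_positive A"
    unfolding op_positive_def
  proof (intro conjI allI impI)
    fix f :: 'a assume "f \<noteq> 0"
    have "linear X"
      using op_invertible_bounded[OF X] by (simp add: bounded_clinear_def bounded_linear.linear)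
    then have "inv X f \<noteq> 0"
      using \<open>f \<noteq> 0\<close> op_invertible_apply_inv(1)[OF X, of f] by (auto simp: linear_0)
    moreover have "cinner (A f) f = cinner (q' (inv X f)) (inv X f)"
      using A_X[of "inv X f" "inv X f"] by (simp add: op_invertible_apply_inv[OF X])
    ultimately show "cinner (A f) f \<in> \<real>" "0 < Re (cinner (A f) f)"
      using q'(1) by (auto simp: op_positive_def)
  qed (rule op_invertible_bounded[OF inv])
  then obtain V where V: "op_positive V" "op_invertible V" "V \<circ> V = A"
    using op_positive_sqrt inv by blast
  have "cinner (V (X x)) (V (X y)) = cinner (q' x) y" for x y
    using A_X[of x y] op_positive_symmetric[OF V(1), of "V (X x)" "X y"]
    by (simp add: V(3)[symmetric])
  with V that show ?thesis by blast
qed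

lemma op_factor_sequence:
  fixes q :: "nat \<Rightarrow> 'a::complex_hilbert_space \<Rightarrow> 'a"
  assumes pos: "\<And>n. op_positive (q n)" and inv: "\<And>n. op_invertible (q n)" and "q 0 = id"
  obtains X V where "X 0 = id" "\<And>n. op_positive (V n)" "\<And>n. op_invertible (V n)"
    "\<And>n. X (Suc n) = V n \<circ> X n" "\<And>n. op_invertible (X n)"
    "\<And>n x y. cinner (X n x) (X n y) = cinner (q n x) y"
proof -
  \<comment> \<open>Dependent choice does not prescribe the initial value, so the invariant itself
    forces \<open>X = id\<close> at index 0.\<close>
  define P where "P n X \<longleftrightarrow> op_invertible X \<and> (\<forall>x y. cinner (X x) (X y) = cinner (q n x) y)
    \<and> (n = 0 \<longrightarrow> X = id)" for n X
  define Q where "Q X X' \<longleftrightarrow> (\<exists>V. op_positive V \<and> op_invertible V \<and> X' = V \<circ> X)"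
    for X X' :: "'a \<Rightarrow> 'a"
  have "P 0 id" using \<open>q 0 = id\<close> by (auto simp: P_def)
  moreover have "\<exists>X'. P (Suc n) X' \<and> Q X X'" if PX: "P n X" for n X
  proof -
    have X: "op_invertible X" and gram: "\<And>x y. cinner (X x) (X y) = cinner (q n x) y"
      using PX by (auto simp: P_def)
    obtain V where V: "op_positive V" "op_invertible V"
        "\<And>x y. cinner (V (X x)) (V (X y)) = cinner (q (Suc n) x) y"
      using op_factor_step[OF X inv[of n] pos[of "Suc n"] inv[of "Suc n"] gram] by metis
    then show ?thesis
      using X by (intro exI[of _ "V \<circ> X"]) (auto simp: P_def Q_def)
  qed
  ultimately obtain X where X: "\<And>n. P n (X n)" "\<And>n. Q (X n) (X (Suc n))"
    using dependent_nat_choice[of P "\<lambda>_. Q"] by blast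
  from X(2) obtain V where
    "\<And>n. op_positive (V n) \<and> op_invertible (V n) \<and> X (Suc n) = V n \<circ> X n"
    unfolding Q_def by metis
  with X(1) show ?thesis
    by (intro that[of X V]) (auto simp: P_def)
qed

text \<open>
  Backwards from \<open>0\<close> the same construction yields the inverses of the weights.
\<close>

lemma op_factor_bilateral:
  fixes q :: "int \<Rightarrow> 'a::complex_hilbert_space \<Rightarrow> 'a"
  assumes pos: "\<And>n. op_positive (q n)" and inv: "\<And>n. op_invertible (q n)" and q0: "q 0 = id"
  obtains X W where "X 0 = id" "\<And>j. op_positive (W j)" "\<And>j. op_invertible (W j)"
    "\<And>j. X j = W j \<circ> X (j - 1)" "\<And>j. op_invertible (X j)"
    "\<And>j x y. cinner (X j x) (X j y) = cinner (q j x) y"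
proof -
  obtain X V where X: "X 0 = id" "\<And>n. op_positive (V n)" "\<And>n. op_invertible (V n)"
      "\<And>n. X (Suc n) = V n \<circ> X n" "\<And>n. op_invertible (X n)"
      "\<And>n x y. cinner (X n x) (X n y) = cinner (q (int n) x) y"
    by (rule op_factor_sequence[of "\<lambda>n. q (int n)"]) (auto simp: pos inv q0)
  obtain Z U where Z: "Z 0 = id" "\<And>n. op_positive (U n)" "\<And>n. op_invertible (U n)"
      "\<And>n. Z (Suc n) = U n \<circ> Z n" "\<And>n. op_invertible (Z n)"
      "\<And>n x y. cinner (Z n x) (Z n y) = cinner (q (- int n) x) y"
    by (rule op_factor_sequence[of "\<lambda>n. q (- int n)"]) (auto simp: pos inv q0)
  define Y where "Y j = (if 0 \<le> j then X (nat j) else Z (nat (- j)))" for j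
  \<comment> \<open>For \<open>j \<le> 0\<close> the backward step reads
    \<open>Y (j - 1) = U (nat (- j)) \<circ> Y j\<close>, so the weight from \<open>j - 1\<close> to
    \<open>j\<close> is the inverse of that \<open>U\<close>.\<close>
  define W where "W j = (if 1 \<le> j then V (nat (j - 1)) else inv (U (nat (- j))))" for j
  have "Y j = W j \<circ> Y (j - 1)" for j
  proof (cases "1 \<le> j")
    case True
    then have "nat j = Suc (nat (j - 1))" by simp
    with True show ?thesis by (simp add: Y_def W_def X(4))
  next
    case False
    then have "nat (1 - j) = Suc (nat (- j))" by simp
    with False have "Y (j - 1) = U (nat (- j)) \<circ> Z (nat (- j))" by (simp add: Y_def Z(4))
    \<comment> \<open>At \<open>j = 0\<close> the definition selects \<open>X\<close>; both
      sequences start at the identity, so they agree there.\<close>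
    moreover have "Y j = Z (nat (- j))" using False by (cases "j = 0") (auto simp: Y_def X(1) Z(1))
    ultimately show ?thesis
      using False by (simp add: W_def fun_eq_iff op_invertible_apply_inv[OF Z(3)])
  qed
  moreover have "cinner (Y j x) (Y j y) = cinner (q j x) y" for j x y
    by (simp add: Y_def X(6) Z(6))
  ultimately show ?thesis
    by (intro that[of Y W])
      (auto simp: Y_def W_def X Z intro: op_positive_inv op_invertible_inv X Z)
qed

section \<open>Products of the weights\<close>

lemma op_prod_forward:
  assumes "X 0 = id" "\<And>j::int. X j = W j \<circ> X (j - 1)" "0 \<le> n"
  shows "op_prod (map W (rev [1..n])) = X n"
  using assms(3)
proof (induction n rule: int_ge_induct)
  case base
  then show ?case by (simp add: op_prod_def assms(1))
next
  case (step n)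
  then show ?case
    using assms(2)[of "n + 1"] by (simp add: op_prod_def upto_rec2)
qed

text \<open>Since \<open>X 0 = id\<close>, the weights telescope to
  \<open>W 0 ... W (- n + 1) = inv (X (- n))\<close>. Taking adjoints of the symmetric weights
  reverses the order. The vector \<open>y\<close> is generalized because each new factor is moved
  onto it.\<close>

lemma op_prod_backward_adjoint:
  assumes "X 0 = id" "\<And>j::int. X j = W j \<circ> X (j - 1)" "\<And>j. op_positive (W j)"
    "\<And>j. op_invertible (X j)" "0 \<le> n"
  shows "cinner (op_prod (map W [- n + 1..0]) x) y = cinner x (inv (X (- n)) y)"
  using assms(5)
proof (induction n arbitrary: y rule: int_ge_induct)
  case base
  then show ?case by (simp add: op_prod_def assms(1))
next
  case (step n)
  have "X (- n) (inv (X (- n - 1)) y) = W (- n) y"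
    using assms(2)[of "- n"] by (simp add: op_invertible_apply_inv[OF assms(4)])
  then have "inv (X (- n)) (W (- n) y) = inv (X (- n - 1)) y"
    by (metis op_invertible_apply_inv(2)[OF assms(4)])
  moreover have "[- (n + 1) + 1..0] = - n # [- n + 1..0]"
    using step(1) by (simp add: upto_rec1)
  ultimately show ?case
    using step(2)[of "W (- n) y"]
    by (simp add: op_prod_def op_positive_symmetric[OF assms(3)])
qed

section \<open>Weighted shifts\<close>

text \<open>One construction for both the shift, with \<open>s i = i - 1\<close>, and its adjoint,
  with \<open>s i = i + 1\<close>.\<close>

lemma ell2Z_weighted_reindex:
  fixes V :: "int \<Rightarrow> 'a::complex_inner \<Rightarrow> 'a"
  assumes V: "\<And>i. bounded_clinear (V i)" "\<And>i x. norm (V i x) \<le> K * norm x"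
    and K: "0 \<le> K" and s: "bij s"
  obtains T :: "'a ell2Z \<Rightarrow> 'a ell2Z" where "bounded_clinear T"
    "\<And>h i. ell2Z_nth (T h) i = V i (ell2Z_nth h (s i))" "\<And>h. norm (T h) \<le> K * norm h"
proof -
  have le: "(norm (V i x))\<^sup>2 \<le> K\<^sup>2 * (norm x)\<^sup>2" for i x
    using power_mono[OF V(2)[of i x] norm_ge_zero, of 2] by (simp add: power_mult_distrib)
  have summ: "(\<lambda>i. K\<^sup>2 * (norm (ell2Z_nth h (s i)))\<^sup>2) summable_on UNIV" for h :: "'a ell2Z"
    using ell2Z_nth[of h]
      summable_on_reindex_bij_betw[OF s, of "\<lambda>i. (norm (ell2Z_nth h i))\<^sup>2"]
    by (intro summable_on_cmult_right) simp
  define T :: "'a ell2Z \<Rightarrow> 'a ell2Z" where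
    "T h = Abs_ell2Z (\<lambda>i. V i (ell2Z_nth h (s i)))" for h
  have T: "ell2Z_nth (T h) i = V i (ell2Z_nth h (s i))" for h i
  proof -
    have "(\<lambda>i. (norm (V i (ell2Z_nth h (s i))))\<^sup>2) summable_on UNIV"
      by (rule summable_on_comparison_test[OF summ]) (auto intro: le)
    then show ?thesis by (simp add: T_def Abs_ell2Z_inverse)
  qed
  have norm: "norm (T h) \<le> K * norm h" for h
  proof -
    have "(norm (T h))\<^sup>2 \<le> (\<Sum>\<^sub>\<infinity>i. K\<^sup>2 * (norm (ell2Z_nth h (s i)))\<^sup>2)"
      unfolding norm_sq_ell2Z
      by (rule infsum_mono[OF _ summ]) (use ell2Z_nth[of "T h"] le in \<open>auto simp: T\<close>)
    also have "\<dots> = K\<^sup>2 * (\<Sum>\<^sub>\<infinity>i. (norm (ell2Z_nth h (s i)))\<^sup>2)"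
      by (rule infsum_cmult_right')
    also have "\<dots> = (K * norm h)\<^sup>2"
      by (simp add: power_mult_distrib norm_sq_ell2Z
          infsum_reindex_bij_betw[OF s, of "\<lambda>i. (norm (ell2Z_nth h i))\<^sup>2"])
    finally show ?thesis by (rule power2_le_imp_le) (simp add: K)
  qed
  have lin: "V i (x + y) = V i x + V i y" "V i (c *\<^sub>C x) = c *\<^sub>C V i x" for i x y c
    using V(1)[of i] by (auto simp: bounded_clinear_def linear_add bounded_linear.linear)
  have add: "T (x + y) = T x + T y" and scale: "T (c *\<^sub>C x) = c *\<^sub>C T x" for x y c
    by (simp_all add: ell2Z_nth_inject[symmetric] fun_eq_iff T plus_ell2Z.rep_eq
        scaleC_ell2Z.rep_eq lin)
  have "bounded_clinear T"
    unfolding bounded_clinear_def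
  proof (intro conjI allI scale bounded_linear_intro add)
    show "T (r *\<^sub>R x) = r *\<^sub>R T x" for r x by (simp add: scaleC_of_real[symmetric] scale)
    show "norm (T h) \<le> norm h * K" for h using norm[of h] by (simp add: mult.commute)
  qed
  with T norm that show ?thesis by blast
qed

lemma bilateral_weighted_shift_exists:
  assumes W: "\<And>i. bounded_clinear (W i)" "\<And>i x. norm (W i x) \<le> K * norm x" and K: "0 \<le> K"
  obtains S where "bilateral_weighted_shift W S" "onorm S \<le> K"
proof -
  obtain S where S: "bounded_clinear S"
      "\<And>h i. ell2Z_nth (S h) i = W i (ell2Z_nth h (i - 1))" "\<And>h. norm (S h) \<le> K * norm h"
    by (rule ell2Z_weighted_reindex[OF W K bij_diff_right[of 1]]) (rule that)
  moreover have "onorm (W i) \<le> K" for i by (rule onorm_bound[OF K W(2)])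
  ultimately have "bilateral_weighted_shift W S"
    using W(1) by (auto simp: bilateral_weighted_shift_def)
  then show ?thesis using onorm_bound[OF K S(3)] by (rule that)
qed

text \<open>A sequence supported at the single index \<open>i - 1\<close> isolates the weight
  \<open>W i\<close>.\<close>

lemma norm_weight_le_onorm:
  assumes "bilateral_weighted_shift W S"
  shows "norm (W i x) \<le> onorm S * norm x"
proof -
  define h where "h j = (if j = i - 1 then x else 0)" for j
  have sum: "((\<lambda>j. (norm (h j))\<^sup>2) has_sum (norm x)\<^sup>2) UNIV"
    by (rule has_sum_finite_neutralI[where B = "{i - 1}"]) (auto simp: h_def)
  define f where "f = Abs_ell2Z h"
  have nth: "ell2Z_nth f = h"
    using has_sum_imp_summable[OF sum] by (simp add: f_def Abs_ell2Z_inverse)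
  have "(norm f)\<^sup>2 = (norm x)\<^sup>2"
    unfolding norm_sq_ell2Z nth by (rule infsumI[OF sum])
  then have "norm f = norm x" by simp
  moreover have "ell2Z_nth (S f) i = W i x"
    using assms by (simp add: bilateral_weighted_shift_def nth h_def)
  then have "norm (W i x) \<le> norm (S f)"
    using norm_nth_le_ell2Z[of "S f" i] by simp
  moreover have "norm (S f) \<le> onorm S * norm f"
    using assms by (intro onorm) (auto simp: bilateral_weighted_shift_def bounded_clinear_def)
  ultimately show ?thesis by simp
qed

text \<open>The adjoint is the backward shift with the same symmetric weights;
  \<open>onorm S\<close> bounds them uniformly.\<close>

lemma cadjoint_bilateral_weighted_shift:
  assumes S: "bilateral_weighted_shift W S" and W: "\<And>i. op_positive (W i)"
  shows "bounded_clinear (cadjoint S)" "cinner (S f) g = cinner f (cadjoint S g)"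
proof -
  have nth: "ell2Z_nth (S h) i = W i (ell2Z_nth h (i - 1))" for h i
    using S by (auto simp: bilateral_weighted_shift_def)
  have "bounded_linear S" using S by (auto simp: bilateral_weighted_shift_def bounded_clinear_def)
  then have "0 \<le> onorm S" by (rule onorm_pos_le)
  moreover have "bij (\<lambda>i::int. i + 1)" by (rule bij_plus_right)
  ultimately obtain R where R: "bounded_clinear R"
      "\<And>h i. ell2Z_nth (R h) i = W (i + 1) (ell2Z_nth h (i + 1))"
    using ell2Z_weighted_reindex[of "\<lambda>i. W (i + 1)" "onorm S" "\<lambda>i. i + 1"]
      norm_weight_le_onorm[OF S] W unfolding op_positive_def by metis
  have adj: "cinner (S f) g = cinner f (R g)" for f g
  proof -
    have "cinner (S f) g = (\<Sum>\<^sub>\<infinity>i. cinner (ell2Z_nth f (i - 1)) (W i (ell2Z_nth g i)))"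
      by (simp add: cinner_ell2Z.rep_eq nth op_positive_symmetric[OF W])
    also have "\<dots> = (\<Sum>\<^sub>\<infinity>i. cinner (ell2Z_nth f i) (W (i + 1) (ell2Z_nth g (i + 1))))"
      using infsum_reindex_bij_betw[OF bij_plus_right[of "1::int"],
          of "\<lambda>i. cinner (ell2Z_nth f (i - 1)) (W i (ell2Z_nth g i))"] by simp
    finally show ?thesis by (simp add: cinner_ell2Z.rep_eq R(2))
  qed
  have "cadjoint S = R" by (rule cadjoint_eqI[OF R(1) adj])
  with R(1) adj show "bounded_clinear (cadjoint S)" "cinner (S f) g = cinner f (cadjoint S g)"
    by simp_all
qed

text \<open>The product \<open>W i ... W (i - k + 1)\<close> telescopes to
  \<open>X i \<circ> inv (X (i - k))\<close>.\<close>

lemma nth_shift_power: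
  assumes S: "bilateral_weighted_shift W S" and X: "\<And>j. X j = W j \<circ> X (j - 1)"
    and inv: "\<And>j. op_invertible (X j)"
  shows "ell2Z_nth ((S ^^ k) h) i = X i (inv (X (i - int k)) (ell2Z_nth h (i - int k)))"
proof (induction k arbitrary: i)
  case 0
  show ?case by (simp add: op_invertible_apply_inv[OF inv])
next
  case (Suc k)
  have "ell2Z_nth ((S ^^ Suc k) h) i = W i (ell2Z_nth ((S ^^ k) h) (i - 1))"
    using S by (simp add: bilateral_weighted_shift_def)
  also have "\<dots> = X i (inv (X (i - 1 - int k)) (ell2Z_nth h (i - 1 - int k)))"
    unfolding Suc.IH by (subst (3) X) simp
  finally show ?case by (simp add: algebra_simps)
qed

section \<open>Finite differences of operator polynomials\<close>

text \<open>Induction on the exponent: one factor \<open>z + k\<close> is split off. The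
  \<open>z\<close> part has a lower exponent, and in the \<open>k\<close> part absorption lowers
  \<open>m\<close> by one and shifts \<open>z\<close> to \<open>z + 1\<close>, hence the
  generalization over both.\<close>

lemma alternating_binomial_power_sum:
  fixes z :: "'a::comm_ring_1"
  assumes "l < m"
  shows "(\<Sum>k\<le>m. (-1) ^ k * of_nat (m choose k) * (z + of_nat k) ^ l) = 0"
  using assms
proof (induction l arbitrary: m z)
  case 0
  then show ?case using choose_alternating_sum[of m] by simp
next
  case (Suc l)
  then obtain n where m: "m = Suc n" "l < n" by (cases m) auto
  let ?c = "\<lambda>k. (-1) ^ k * of_nat (m choose k) :: 'a"
  have "(\<Sum>k\<le>m. ?c k * (z + of_nat k) ^ Suc l) =
      z * (\<Sum>k\<le>m. ?c k * (z + of_nat k) ^ l) + (\<Sum>k\<le>m. ?c k * of_nat k * (z + of_nat k) ^ l)"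
    by (simp add: sum_distrib_left sum.distrib[symmetric] algebra_simps)
  also have "(\<Sum>k\<le>m. ?c k * (z + of_nat k) ^ l) = 0"
    using Suc.IH[of m z] Suc.prems by simp
  \<comment> \<open>The term \<open>k = 0\<close> vanishes, which allows the index shift that
    prepares the absorption identity.\<close>
  also have "(\<Sum>k\<le>m. ?c k * of_nat k * (z + of_nat k) ^ l) =
      (\<Sum>k\<le>n. (-1) ^ Suc k * of_nat (Suc k * (Suc n choose Suc k)) * (z + of_nat (Suc k)) ^ l)"
    unfolding m(1) by (subst sum.atMost_Suc_shift) (simp add: algebra_simps)
  also have "\<dots> = - of_nat (Suc n) *
      (\<Sum>k\<le>n. (-1) ^ k * of_nat (n choose k) * ((z + 1) + of_nat k) ^ l)"
    unfolding Suc_times_binomial sum_distrib_left by (intro sum.cong) (simp_all add: algebra_simps)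
  also have "\<dots> = 0" using Suc.IH[OF m(2), of "z + 1"] by simp
  finally show ?case by simp
qed

lemma op_polys_finite_difference:
  assumes p: "p \<in> op_polys (m - 1)" and m: "1 \<le> m"
  shows "(\<Sum>k=0..m. of_nat (m choose k) * (-1) ^ (m - k) * cinner (p (z + of_nat k) u) v) = 0"
proof -
  obtain A where A: "p = (\<lambda>z h. \<Sum>j=0..m - 1. z ^ j *\<^sub>C A j h)"
    using p by (auto simp: op_polys_def)
  have sign: "(-1) ^ (m - k) = (-1) ^ m * ((-1) ^ k :: complex)" if "k \<le> m" for k
    using that by (simp add: minus_one_power_iff)
  have "(\<Sum>k=0..m. of_nat (m choose k) * (-1) ^ (m - k) * cinner (p (z + of_nat k) u) v) =
      (\<Sum>k=0..m. \<Sum>j=0..m - 1. (-1) ^ m * cinner (A j u) v *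
        ((-1) ^ k * of_nat (m choose k) * (z + of_nat k) ^ j))"
    by (intro sum.cong refl)
      (simp add: A sign cinner_sum_left cinner_scaleC_left sum_distrib_left algebra_simps)
  also have "\<dots> = (\<Sum>j=0..m - 1. (-1) ^ m * cinner (A j u) v *
      (\<Sum>k\<le>m. (-1) ^ k * of_nat (m choose k) * (z + of_nat k) ^ j))"
    by (subst sum.swap) (simp add: sum_distrib_left atLeast0AtMost)
  \<comment> \<open>As \<open>m\<close> is at least 1, the truncated difference \<open>m - 1\<close>
    is below \<open>m\<close>, so every exponent \<open>j\<close> is too.\<close>
  also have "\<dots> = 0"
    using m by (intro sum.neutral ballI) (simp add: alternating_binomial_power_sum)
  finally show ?thesis .
qed

section \<open>Weak form of the m-isometry identity\<close>

lemma infsum_finite_sum: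
  fixes f :: "'i \<Rightarrow> 'a \<Rightarrow> 'b::{topological_comm_monoid_add, t2_space}"
  assumes "finite I" "\<And>k. k \<in> I \<Longrightarrow> f k summable_on A"
  shows "(\<lambda>x. \<Sum>k\<in>I. f k x) summable_on A \<and> (\<Sum>\<^sub>\<infinity>x\<in>A. \<Sum>k\<in>I. f k x) = (\<Sum>k\<in>I. infsum (f k) A)"
  using assms by (induction I rule: finite_induct) (simp_all add: infsum_add summable_on_add)

text \<open>Testing the operator sum against every \<open>g\<close> moves the powers of the adjoint
  to the other side as powers of \<open>S\<close>.\<close>

lemma m_isometricI:
  assumes "bounded_clinear S" "\<And>f g. cinner (S f) g = cinner f (cadjoint S g)"
    and "\<And>f g. (\<Sum>k=0..m. of_nat (m choose k) * (-1) ^ (m - k) *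
      cinner ((S ^^ k) f) ((S ^^ k) g)) = 0"
  shows "m_isometric m S"
proof -
  have "cinner (cadjoint S f) g = cinner f (S g)" for f g
    using assms(2)[of g f] cinner_commute[of "cadjoint S f" g] cinner_commute[of f "S g"] by simp
  then have "cinner ((cadjoint S ^^ k) f) g = cinner f ((S ^^ k) g)" for k f g
    by (induction k arbitrary: f) (simp_all add: funpow_swap1)
  then show ?thesis
    unfolding m_isometric_def
    by (intro conjI allI cinner_ext assms(1))
      (simp add: cinner_sum_left cinner_scaleC_left cinner_zero_left assms(3))
qed

section \<open>Assembly of the shift\<close>

theorem theorem4p4:
  fixes p :: "complex \<Rightarrow> 'h::complex_hilbert_space \<Rightarrow> 'h" and m :: nat
  assumes "1 \<le> m"
    and "p \<in> op_polys (m - 1)"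
    and "p 0 = id"
    and "\<And>n::int. op_positive (p (of_int n)) \<and> op_invertible (p (of_int n))"
    and "growth_sup p < \<infinity>"
  shows "\<exists>(S :: 'h ell2Z \<Rightarrow> 'h ell2Z) (W :: int \<Rightarrow> 'h \<Rightarrow> 'h).
      bilateral_weighted_shift W S \<and> m_isometric m S \<and>
      (\<forall>j. op_positive (W j) \<and> op_invertible (W j)) \<and>
      (\<forall>n::int. 1 \<le> n \<longrightarrow>
         p (of_int n) = op_abs (op_prod (map W (rev [1..n]))) ^^ 2 \<and>
         p (of_int (- n)) = op_abs_inv_sq (op_prod (map (\<lambda>j. cadjoint (W j)) [- n + 1..0]))) \<and>
      onorm S = sqrt (enn2real (growth_sup p))"
proof -
  have pos: "op_positive (p (of_int n))" and inv: "op_invertible (p (of_int n))" for n :: int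
    using assms(4) by auto
  have p0: "p (of_int 0) = id" by (simp add: assms(3))
  obtain X W where X0: "X 0 = id" and W: "\<And>j. op_positive (W j)" "\<And>j. op_invertible (W j)"
      and XW: "\<And>j. X j = W j \<circ> X (j - 1)" and X: "\<And>j. op_invertible (X j)"
      and gram: "\<And>j x y. cinner (X j x) (X j y) = cinner (p (of_int j) x) y"
    by (rule op_factor_bilateral[of "\<lambda>n. p (of_int n)", OF pos inv p0]) (rule that)
  have W_X: "W j (X (j - 1) u) = X j u" for j u by (subst (2) XW) simp
  have quad: "cinner (p (of_int j) x) x = complex_of_real ((norm (X j x))\<^sup>2)" for j x
    using gram[of j x x] by (simp add: cinner_self)
  have X_nz: "0 < norm (X j x)" if "x \<noteq> 0" for j x
  proof -
    have "linear (inv (X j))"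
      using op_invertible_bounded[OF op_invertible_inv[OF X]]
      by (simp add: bounded_clinear_def bounded_linear.linear)
    then show ?thesis
      using that op_invertible_apply_inv(2)[OF X, of j x] by (auto simp: linear_0)
  qed
  define D where "D = enn2real (growth_sup p)"
  have D: "growth_sup p = ennreal D" "0 \<le> D"
    using assms(5) by (simp_all add: D_def)
  have growth: "growth_sup p = (SUP (n, h) \<in> (UNIV :: int set) \<times> {h. h \<noteq> 0}.
      ennreal ((norm (X (n + 1) h))\<^sup>2 / (norm (X n h))\<^sup>2))"
    unfolding growth_sup_def quad of_real_divide[symmetric] Re_complex_of_real ..
  have W_le: "norm (W j x) \<le> sqrt D * norm x" for j x
  proof (cases "x = 0")
    case True
    then show ?thesis
      using W(1)[of j] by (simp add: op_positive_def bounded_clinear_def linear_0 bounded_linear.linear)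
  next
    case False
    define u where "u = inv (X (j - 1)) x"
    have x: "x = X (j - 1) u" by (simp add: u_def op_invertible_apply_inv[OF X])
    have "linear (X (j - 1))"
      using op_invertible_bounded[OF X] by (simp add: bounded_clinear_def bounded_linear.linear)
    with False have u: "u \<noteq> 0" using x by (auto simp: linear_0)
    have "ennreal ((norm (X (j - 1 + 1) u))\<^sup>2 / (norm (X (j - 1) u))\<^sup>2) \<le> ennreal D"
      unfolding D(1)[symmetric] growth using u by (intro SUP_upper2[of "(j - 1, u)"]) auto
    then have "(norm (X j u))\<^sup>2 / (norm x)\<^sup>2 \<le> D" using D(2) by (simp add: x)
    then have "(norm (W j x))\<^sup>2 \<le> (sqrt D * norm x)\<^sup>2"
      using False D(2) by (simp add: x W_X power_mult_distrib divide_le_eq)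
    then show ?thesis by (rule power2_le_imp_le) (simp add: D(2))
  qed
  obtain S where S: "bilateral_weighted_shift W S" and S_le: "onorm S \<le> sqrt D"
    using bilateral_weighted_shift_exists[of W "sqrt D"] W(1) W_le D(2)
    by (auto simp: op_positive_def)
  have S_bdd: "bounded_clinear S" using S by (simp add: bilateral_weighted_shift_def)
  have S_nonneg: "0 \<le> onorm S" using S_bdd by (simp add: bounded_clinear_def onorm_pos_le)
  \<comment> \<open>The converse estimate: each quotient compares \<open>W (n + 1)\<close> with
    \<open>onorm S\<close> at the vector \<open>X n h\<close>.\<close>
  have "growth_sup p \<le> ennreal ((onorm S)\<^sup>2)"
    unfolding growth
  proof (rule SUP_least, clarify)
    fix n :: int and h :: 'h assume "h \<noteq> 0"
    have "norm (X (n + 1) h) \<le> onorm S * norm (X n h)"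
      using norm_weight_le_onorm[OF S, of "n + 1" "X n h"] W_X[of "n + 1" h] by simp
    then have "(norm (X (n + 1) h))\<^sup>2 \<le> (onorm S * norm (X n h))\<^sup>2" by (simp add: power_mono)
    then show "ennreal ((norm (X (n + 1) h))\<^sup>2 / (norm (X n h))\<^sup>2) \<le> ennreal ((onorm S)\<^sup>2)"
      using X_nz[OF \<open>h \<noteq> 0\<close>, of n] by (intro ennreal_leI) (simp add: divide_le_eq power_mult_distrib)
  qed
  then have "D \<le> (onorm S)\<^sup>2" by (simp add: D(1))
  then have "sqrt D \<le> onorm S" using S_nonneg by (simp add: real_le_lsqrt)
  with S_le have norm_S: "onorm S = sqrt D" by simp
  have "m_isometric m S"
  proof (rule m_isometricI[OF S_bdd cadjoint_bilateral_weighted_shift(2)[OF S W(1)]])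
    fix f g :: "'h ell2Z"
    define u where "u j = inv (X j) (ell2Z_nth f j)" for j
    define v where "v j = inv (X j) (ell2Z_nth g j)" for j
    let ?t = "\<lambda>k j. cinner (p (of_int j + of_nat k) (u j)) (v j)"
    \<comment> \<open>Reading the powers at \<open>j + k\<close> keeps \<open>u j\<close> and
      \<open>v j\<close> independent of \<open>k\<close>, so for fixed \<open>j\<close> the sum over
      \<open>k\<close> is a finite difference of a single polynomial.\<close>
    have t: "cinner (ell2Z_nth ((S ^^ k) f) (j + int k)) (ell2Z_nth ((S ^^ k) g) (j + int k))
        = ?t k j" for k j
      by (simp add: nth_shift_power[OF S XW X] gram u_def v_def)
    let ?c = "\<lambda>k. of_nat (m choose k) * (-1) ^ (m - k) :: complex"
    \<comment> \<open>Summability for each \<open>k\<close> licenses the later exchange of the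
      finite sum over \<open>k\<close> with the infinite sum over \<open>j\<close>.\<close>
    have summ: "?t k summable_on UNIV" for k
      unfolding t[symmetric]
      using cinner_summable[of "ell2Z_nth ((S ^^ k) f)" "ell2Z_nth ((S ^^ k) g)"] ell2Z_nth
        summable_on_reindex_bij_betw[OF bij_plus_right[of "int k"],
          of "\<lambda>i. cinner (ell2Z_nth ((S ^^ k) f) i) (ell2Z_nth ((S ^^ k) g) i)"]
      by auto
    have "cinner ((S ^^ k) f) ((S ^^ k) g) = (\<Sum>\<^sub>\<infinity>j. ?t k j)" for k
      unfolding t[symmetric] cinner_ell2Z.rep_eq
      using infsum_reindex_bij_betw[OF bij_plus_right[of "int k"],
          of "\<lambda>i. cinner (ell2Z_nth ((S ^^ k) f) i) (ell2Z_nth ((S ^^ k) g) i)"] by simp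
    then have "(\<Sum>k=0..m. ?c k * cinner ((S ^^ k) f) ((S ^^ k) g)) =
        (\<Sum>k=0..m. \<Sum>\<^sub>\<infinity>j. ?c k * ?t k j)"
      by (simp add: infsum_cmult_right')
    also have "\<dots> = (\<Sum>\<^sub>\<infinity>j. \<Sum>k=0..m. ?c k * ?t k j)"
      using infsum_finite_sum[of "{0..m}" "\<lambda>k j. ?c k * ?t k j" UNIV]
      by (simp add: summable_on_cmult_right summ)
    also have "\<dots> = 0"
      by (simp add: op_polys_finite_difference[OF assms(2,1)])
    finally show "(\<Sum>k=0..m. ?c k * cinner ((S ^^ k) f) ((S ^^ k) g)) = 0" .
  qed
  moreover have "p (of_int n) = op_abs (op_prod (map W (rev [1..n]))) ^^ 2" if "1 \<le> n" for n
    using that op_prod_forward[OF X0 XW, of n]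
      op_abs_squared[OF cadjoint_compose_self[OF X pos gram] pos inv, of n] by simp
  moreover have "p (of_int (- n)) = op_abs_inv_sq (op_prod (map (\<lambda>j. cadjoint (W j)) [- n + 1..0]))"
    if "1 \<le> n" for n
    using that op_abs_inv_sq_eq[OF X inv gram op_prod_backward_adjoint[OF X0 XW W(1) X], of n]
    by (simp add: cadjoint_op_positive[OF W(1)])
  ultimately show ?thesis
    using S W norm_S unfolding D_def by blast
qed

end
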